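(* Let $F$ be as in the context, and for $k\in\mathbb{N}_0$ let $M_k=\int_0^\infty x^k\,dF(x)$ and $m_k=\int_0^\infty\left(\frac{x}{x+1}\right)^k dF(x)$, and set $m(t)=\sum_{k=0}^\infty \frac{m_k}{k!}t^k$. Then for every $\varepsilon>0$ and all $L\in\mathbb{N}_0$, $$M_L=\frac{m(\log 2)}{2\log 2}\Big(\frac{1}{\log 2}\Big)^{L}L!+O_{\varepsilon}\Big(\big((4\pi^2+(\log 2)^2)^{1/2}-\varepsilon\big)^{-L}\Big)L!,$$ and in particular $$M_L=\Big(\frac{m(\log 2)}{2\log 2}\Big(\frac{1}{\log 2}\Big)^{L}+O(6.3^{-L})\Big)L!.$$
   Context: $F:[0,\infty)\to[0,1]$ is the distribution function defined for $x=[a_0,a_1,a_2,\dots]$ (regular continued fraction, $a_0\ge0$, $a_i\ge1$; the series terminating for rational $x$) by $F(x)=1-2^{-a_0}+2^{-(a_0+a_1)}-2^{-(a_0+a_1+a_2)}+\cdots$; it is the limit distribution of the elements of the $n$th generation of the Calkin--Wilf tree. All moments $M_k$ are finite, and $m(t)$ is an entire function. *)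

theory Defs
  imports "HOL-Analysis.Analysis"
begin

text \<open>
  Complete quotients of the regular continued fraction
  \<open>x = [a\<^sub>0, a\<^sub>1, a\<^sub>2, \<dots>]\<close>: \<open>Some x\<^sub>n\<close> with \<open>x\<^sub>0 = x\<close> and
  \<open>x\<^sub>n = a\<^sub>n + 1 / x\<^bsub>n+1\<^esub>\<close>, and \<open>None\<close> once the expansion has terminated.
\<close>

primrec cf_quot :: "real \<Rightarrow> nat \<Rightarrow> real option" where
  "cf_quot x 0 = Some x"
| "cf_quot x (Suc n) =
     (case cf_quot x n of
        None \<Rightarrow> None
      | Some y \<Rightarrow> if y \<in> \<int> then None else Some (1 / frac y))"

text \<open>The partial quotient \<open>a\<^sub>n\<close>; only meaningful if \<open>cf_quot x n\<close> is not \<open>None\<close>.\<close>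

definition cf_digit :: "real \<Rightarrow> nat \<Rightarrow> nat" where
  "cf_digit x n = nat \<lfloor>the (cf_quot x n)\<rfloor>"

text \<open>
  For rational \<open>x\<close> the last partial quotient produced here is at least 2 (unless it is \<open>a\<^sub>0\<close>).
  The other expansion, with \<open>a\<^sub>n\<close> replaced by \<open>a\<^sub>n - 1, 1\<close>, gives the same value of \<open>CW_F\<close>.
  The extension by 0 to negative arguments is needed for \<^const>\<open>interval_measure\<close>; since
  \<open>CW_F 0 = 0\<close>, it creates no atom at 0.
\<close>

definition CW_F :: "real \<Rightarrow> real" where
  "CW_F x =
     (if x < 0 then 0
      else 1 + (\<Sum>n. if cf_quot x n = None then 0
                     else (-1) ^ Suc n / 2 ^ (\<Sum>i\<le>n. cf_digit x i)))"

definition CW_M :: "nat \<Rightarrow> real" where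
  "CW_M k = (LINT x:{0..}|interval_measure CW_F. x ^ k)"

definition CW_m :: "nat \<Rightarrow> real" where
  "CW_m k = (LINT x:{0..}|interval_measure CW_F. (x / (x + 1)) ^ k)"

definition CW_m_gf :: "'a::{real_normed_algebra_1,banach} \<Rightarrow> 'a" where
  "CW_m_gf t = (\<Sum>k. (CW_m k / fact k) *\<^sub>R t ^ k)"

end

theory Submission
  imports Defs "HOL-Probability.Probability" "HOL-Complex_Analysis.Complex_Analysis"
begin

text \<open>
  The continued fraction expansion yields \<open>F (x + 1) = (1 + F x) / 2\<close> and \<open>F (x / (x + 1)) = F x / 2\<close>.
  So half of the measure \<open>dF\<close> is its image under \<open>x \<mapsto> x + 1\<close> and the other half is its image
  under \<open>x \<mapsto> x / (x + 1)\<close>, whence \<open>M(t) = (exp t * M(t) + m(t)) / 2\<close> for the exponential generating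
  function \<open>M\<close> of the moments, i.e. \<open>M(t) = m(t) / (2 - exp t)\<close>. As \<open>m\<close> is entire, the only
  singularity of \<open>M\<close> in the disc of radius \<open>sqrt (4 * pi^2 + (ln 2)^2)\<close> is a simple pole at \<open>ln 2\<close>.
  Its principal part gives the main term, and Cauchy's inequality for the remainder the error term.
\<close>

subsection \<open>The distribution function\<close>

definition CW_term :: "real \<Rightarrow> nat \<Rightarrow> real" where
  "CW_term x n = (if cf_quot x n = None then 0 else (-1) ^ Suc n / 2 ^ (\<Sum>i\<le>n. cf_digit x i))"

lemma CW_F_eq: "x \<ge> 0 \<Longrightarrow> CW_F x = 1 + (\<Sum>n. CW_term x n)"
  by (simp add: CW_F_def CW_term_def)

lemma cf_quot_defined_antimono:
  assumes "cf_quot x n \<noteq> None" "m \<le> n"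
  shows "cf_quot x m \<noteq> None"
proof
  assume "cf_quot x m = None"
  with \<open>m \<le> n\<close> have "cf_quot x n = None"
    by (induction rule: dec_induct) auto
  with assms(1) show False ..
qed

lemma cf_digit_ge_1:
  assumes "cf_quot x (Suc n) \<noteq> None"
  shows "cf_digit x (Suc n) \<ge> 1"
proof -
  obtain y where y: "cf_quot x n = Some y" "y \<notin> \<int>"
    using assms by (cases "cf_quot x n") (auto split: if_splits)
  have "0 < frac y" "frac y < 1"
    using y by (auto simp: frac_gt_0_iff frac_lt_1)
  then show ?thesis
    using y by (simp add: cf_digit_def le_nat_iff le_floor_iff)
qed

text \<open>All partial quotients after \<open>a_0\<close> are at least 1, so the exponents in the
  series grow at least linearly. This gives a geometric majorant uniform in
  \<open>x\<close>.\<close>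

lemma le_sum_cf_digit:
  assumes "cf_quot x n \<noteq> None"
  shows "n \<le> (\<Sum>i\<le>n. cf_digit x i)"
  using assms
proof (induction n)
  case (Suc n)
  moreover have "cf_quot x n \<noteq> None"
    using Suc.prems cf_quot_defined_antimono[of x "Suc n" n] by simp
  ultimately show ?case
    using cf_digit_ge_1[of x n] by simp
qed simp

lemma norm_CW_term_le: "norm (CW_term x n) \<le> (1 / 2) ^ n"
  using power_increasing[OF le_sum_cf_digit[of x n], of "2 :: real"]
  by (auto simp: CW_term_def power_divide abs_mult power_abs field_simps simp del: sum.atMost_Suc)

lemma summable_CW_term: "summable (CW_term x)"
  by (rule summable_comparison_test'[of "\<lambda>n. (1 / 2) ^ n" 0]) (auto simp: norm_CW_term_le[simplified])

text \<open>A crude uniform bound, needed only to start the induction that yields the sharp bounds 0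
  and 1.\<close>

lemma abs_CW_F_le: "\<bar>CW_F x\<bar> \<le> 3"
proof (cases "x \<ge> 0")
  case True
  have "norm (\<Sum>n. CW_term x n) \<le> (\<Sum>n. (1 / 2) ^ n)"
    by (rule norm_suminf_le) (use norm_CW_term_le in auto)
  also have "\<dots> = (2 :: real)"
    by (subst suminf_geometric) auto
  finally show ?thesis
    using True by (simp add: CW_F_eq)
qed (simp add: CW_F_def)

section \<open>Special values and functional equations of F\<close>

lemma cf_quot_integer: "x \<in> \<int> \<Longrightarrow> cf_quot x (Suc n) = None"
  by (induction n) auto

lemma CW_F_0: "CW_F 0 = 0"
  and CW_F_1: "CW_F 1 = 1 / 2"
proof -
  have "CW_term x n = 0" if "x \<in> \<int>" "n \<notin> {0}" for x n
    using cf_quot_integer[OF that(1)] that(2) by (cases n) (simp_all add: CW_term_def del: cf_quot.simps)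
  then have "(\<Sum>n. CW_term x n) = CW_term x 0" if "x \<in> \<int>" for x
    using suminf_finite[of "{0}" "CW_term x"] that by simp
  then show "CW_F 0 = 0" "CW_F 1 = 1 / 2"
    by (simp_all add: CW_F_eq) (simp_all add: CW_term_def cf_digit_def)
qed

text \<open>Adding 1 changes only \<open>a_0\<close>, since the first step of the expansion looks at
  the fractional part alone. The index starts at \<open>Suc n\<close> because the quotients with
  index 0 do differ.\<close>

lemma cf_quot_add_1: "cf_quot (x + 1) (Suc n) = cf_quot x (Suc n)"
proof (induction n)
  case 0
  have "x + 1 \<in> \<int> \<longleftrightarrow> x \<in> \<int>"
    by (metis Ints_1 Ints_add Ints_diff add_diff_cancel_right')
  then show ?case by (simp add: frac_def)
next
  case (Suc n)
  then show ?case by (metis cf_quot.simps(2))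
qed

lemma CW_F_add_1:
  assumes "x \<ge> 0"
  shows "CW_F (x + 1) = (1 + CW_F x) / 2"
proof -
  have digit: "cf_digit (x + 1) (Suc n) = cf_digit x (Suc n)" for n
    by (simp only: cf_digit_def cf_quot_add_1)
  have digit0: "cf_digit (x + 1) 0 = Suc (cf_digit x 0)"
    using assms by (simp add: cf_digit_def nat_add_distrib)
  have sum_digit: "(\<Sum>i\<le>n. cf_digit (x + 1) i) = Suc (\<Sum>i\<le>n. cf_digit x i)" for n
    by (induction n) (simp_all add: digit digit0)
  have "cf_quot (x + 1) n = None \<longleftrightarrow> cf_quot x n = None" for n
    by (cases n) (simp_all only: cf_quot_add_1, simp_all)
  then have "CW_term (x + 1) = (\<lambda>n. CW_term x n / 2)"
    by (simp add: CW_term_def sum_digit fun_eq_iff)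
  then show ?thesis
    using assms by (simp add: CW_F_eq suminf_divide[OF summable_CW_term] field_simps)
qed

text \<open>For \<open>x\<close> in (0,1) the expansion starts with the digit 0 and
  \<open>frac x = x\<close>, so inversion just deletes that leading digit.\<close>

lemma cf_quot_inverse:
  assumes "0 < x" "x < 1"
  shows "cf_quot x (Suc n) = cf_quot (1 / x) n"
proof (induction n)
  case 0
  have "x \<notin> \<int>"
    using assms by (auto elim!: Ints_cases)
  moreover have "frac x = x"
    using assms by (simp add: frac_eq)
  ultimately show ?case by simp
next
  case (Suc n)
  then show ?case by (metis cf_quot.simps(2))
qed

text \<open>The leading digit 0 contributes -1, which cancels the constant 1. Deleting it shifts the
  index by one and flips every sign, while the digit sums stay the same.\<close>

lemma CW_F_inverse_aux:
  assumes "0 < x" "x < 1"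
  shows "CW_F x = 1 - CW_F (1 / x)"
proof -
  have digit: "cf_digit x (Suc n) = cf_digit (1 / x) n" for n
    by (simp only: cf_digit_def cf_quot_inverse[OF assms])
  have digit0: "cf_digit x 0 = 0"
    using assms by (simp add: cf_digit_def nat_eq_iff floor_eq_iff)
  have sum_digit: "(\<Sum>i\<le>Suc n. cf_digit x i) = (\<Sum>i\<le>n. cf_digit (1 / x) i)" for n
    by (subst sum.atMost_Suc_shift) (simp add: digit digit0)
  have "CW_term x (Suc n) = - CW_term (1 / x) n" for n
    by (simp only: CW_term_def sum_digit cf_quot_inverse[OF assms]) simp
  moreover have "(\<Sum>n. CW_term x n) = CW_term x 0 + (\<Sum>n. CW_term x (Suc n))"
    using suminf_split_head[OF summable_CW_term[of x]] by simp
  moreover have "CW_term x 0 = -1"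
    by (simp add: CW_term_def digit0)
  ultimately show ?thesis
    using assms by (simp add: CW_F_eq suminf_minus[OF summable_CW_term])
qed

lemma CW_F_inverse:
  assumes "x > 0"
  shows "CW_F x = 1 - CW_F (1 / x)"
proof -
  consider "x < 1" | "x = 1" | "x > 1" by linarith
  then show ?thesis
  proof cases
    case 3
    then show ?thesis
      using CW_F_inverse_aux[of "1 / x"] by simp
  qed (use CW_F_inverse_aux[of x] assms CW_F_1 in auto)
qed

text \<open>Inversion conjugates the shift to this map: \<open>x / (x + 1)\<close> is the reciprocal
  of \<open>1 / x + 1\<close>. The reflection formula therefore transfers the equation for
  \<open>x + 1\<close>.\<close>

lemma CW_F_div_add_1:
  assumes "x \<ge> 0"
  shows "CW_F (x / (x + 1)) = CW_F x / 2"
proof (cases "x = 0")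
  case True
  then show ?thesis by (simp add: CW_F_0)
next
  case False
  with assms have x: "x > 0" by simp
  have "CW_F (x / (x + 1)) = 1 - CW_F (1 / x + 1)"
    using CW_F_inverse[of "x / (x + 1)"] x by (simp add: add_divide_distrib add.commute)
  also have "\<dots> = (1 - CW_F (1 / x)) / 2"
    using CW_F_add_1[of "1 / x"] x by (simp add: field_simps)
  finally show ?thesis
    using CW_F_inverse[OF x] by simp
qed

lemma CW_F_ge_1: "x \<ge> 1 \<Longrightarrow> CW_F x = (1 + CW_F (x - 1)) / 2"
  using CW_F_add_1[of "x - 1"] by simp

lemma CW_F_lt_1:
  assumes "0 \<le> x" "x < 1"
  shows "CW_F x = CW_F (x / (1 - x)) / 2"
proof -
  have "x / (1 - x) + 1 = 1 / (1 - x)"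
    using assms by (simp add: field_simps)
  then show ?thesis
    using CW_F_div_add_1[of "x / (1 - x)"] assms by simp
qed

section \<open>F as a distribution function: bounds, monotonicity, right continuity, limits\<close>

lemma le_of_le_add_power:
  fixes a b c :: real
  assumes "\<And>n. a \<le> b + c / 2 ^ n"
  shows "a \<le> b"
proof (rule LIMSEQ_le_const)
  have "(\<lambda>n. b + c * (1 / 2) ^ n) \<longlonglongrightarrow> b + c * 0"
    by (intro tendsto_intros) auto
  then show "(\<lambda>n. b + c / 2 ^ n) \<longlonglongrightarrow> b"
    by (simp add: power_divide)
qed (use assms in auto)

text \<open>Either functional equation expresses F at \<open>x\<close> through F at another
  nonnegative point with factor 1/2, so each unfolding halves the possible violation of the bounds.
  It starts from the crude bound 3.\<close>

lemma CW_F_nonneg: "CW_F x \<ge> 0"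
  and CW_F_le_1: "CW_F x \<le> 1"
proof -
  have *: "0 \<le> CW_F x + 3 / 2 ^ n \<and> CW_F x \<le> 1 + 3 / 2 ^ n" if "x \<ge> 0" for x n
    using that
  proof (induction n arbitrary: x)
    case 0
    show ?case using abs_CW_F_le[of x] by (simp add: abs_le_iff)
  next
    case (Suc n)
    \<comment> \<open>With the slack named, the induction step is linear arithmetic from slack
      \<open>c\<close> to slack \<open>c / 2\<close>.\<close>
    define c :: real where "c = 3 / 2 ^ n"
    have c: "c > 0" "3 / 2 ^ Suc n = c / 2" by (simp_all add: c_def)
    note IH = Suc.IH[folded c_def]
    show ?case
    proof (cases "x \<ge> 1")
      case True
      then have "x - 1 \<ge> 0" by simp
      from IH[OF this] c(1) show ?thesis
        unfolding c(2) CW_F_ge_1[OF True] by (simp add: field_simps)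
    next
      case False
      then have x: "x < 1" "x / (1 - x) \<ge> 0" using Suc.prems by simp_all
      from IH[OF x(2)] c(1) show ?thesis
        unfolding c(2) CW_F_lt_1[OF Suc.prems x(1)] by (intro conjI; linarith)
    qed
  qed
  have "0 \<le> CW_F x \<and> CW_F x \<le> 1"
  proof (cases "x \<ge> 0")
    case True
    show ?thesis
      using le_of_le_add_power[of 0 "CW_F x" 3] le_of_le_add_power[of "CW_F x" 1 3] *[OF True] by blast
  qed (simp add: CW_F_def)
  then show "CW_F x \<ge> 0" "CW_F x \<le> 1" by auto
qed

text \<open>Again a halving argument. If both points lie on the same side of 1, the same increasing
  map is applied to both and the defect halves; if 1 separates them, the value 1/2 separates F at
  the two points.\<close>

lemma CW_F_mono:
  assumes "x \<le> y"
  shows "CW_F x \<le> CW_F y"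
proof (cases "x \<ge> 0")
  case True
  have "CW_F x \<le> CW_F y + 1 / 2 ^ n" for n
    using True assms
  proof (induction n arbitrary: x y)
    case 0
    show ?case using CW_F_le_1[of x] CW_F_nonneg[of y] by simp
  next
    case (Suc n)
    define c :: real where "c = 1 / 2 ^ n"
    have c: "c > 0" "1 / 2 ^ Suc n = c / 2" by (simp_all add: c_def)
    note IH = Suc.IH[folded c_def]
    consider "x \<ge> 1" | "x < 1" "y \<ge> 1" | "y < 1" using Suc.prems by linarith
    then show ?case
    proof cases
      case 1
      then have y: "y \<ge> 1" and *: "0 \<le> x - 1" "x - 1 \<le> y - 1"
        using Suc.prems by simp_all
      from IH[OF *] show ?thesis
        unfolding c(2) CW_F_ge_1[OF 1] CW_F_ge_1[OF y] by (simp add: field_simps)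
    next
      case 2
      have "CW_F x \<le> 1 / 2" "CW_F y \<ge> 1 / 2"
        using 2 Suc.prems CW_F_le_1 CW_F_nonneg by (simp_all add: CW_F_lt_1 CW_F_ge_1)
      then show ?thesis using c(1) unfolding c(2) by linarith
    next
      case 3
      then have *: "0 \<le> x / (1 - x)" "x / (1 - x) \<le> y / (1 - y)"
        using Suc.prems by (simp_all add: field_simps)
      have xy: "0 \<le> y" "x < 1"
        using 3 Suc.prems by linarith+
      from IH[OF *] show ?thesis
        unfolding c(2) CW_F_lt_1[OF Suc.prems(1) xy(2)] CW_F_lt_1[OF xy(1) 3] by linarith
    qed
  qed
  then show ?thesis by (rule le_of_le_add_power)
qed (simp add: CW_F_def[of x] CW_F_nonneg)

text \<open>The branches [0,1) and [1,oo) are closed on the left, so points slightly to the right of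
  \<open>x\<close> stay in the branch of \<open>x\<close>. One application of the functional
  equation there halves the oscillation.\<close>

lemma CW_F_right_oscillation:
  assumes "x \<ge> 0"
  shows "eventually (\<lambda>y. CW_F y \<le> CW_F x + 1 / 2 ^ n) (at_right x)"
  using assms
proof (induction n arbitrary: x)
  case 0
  show ?case
    using CW_F_le_1 CW_F_nonneg by (auto intro!: always_eventually simp: add_increasing)
next
  case (Suc n)
  define c :: real where "c = 1 / 2 ^ n"
  have c: "1 / 2 ^ Suc n = c / 2" by (simp add: c_def)
  note IH = Suc.IH[folded c_def]
  show ?case
  proof (cases "x \<ge> 1")
    case True
    have "filterlim (\<lambda>y. y - 1) (at_right (x - 1)) (at_right x)"
      unfolding filterlim_at
      by (auto intro!: tendsto_intros eventually_at_right_less simp: eventually_at_filter)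
    then have "eventually (\<lambda>y. CW_F (y - 1) \<le> CW_F (x - 1) + c) (at_right x)"
      using IH[of "x - 1"] True by (auto simp: filterlim_iff)
    moreover have "eventually (\<lambda>y. y > x) (at_right x)"
      by (rule eventually_at_right_less)
    ultimately show ?thesis
    proof eventually_elim
      case (elim y)
      then have y: "1 \<le> y" using True by linarith
      show ?case
        using elim unfolding c CW_F_ge_1[OF True] CW_F_ge_1[OF y] by (simp add: field_simps)
    qed
  next
    case False
    have less: "eventually (\<lambda>y. x < y \<and> y < 1) (at_right x)"
      using False by (intro eventually_at_rightI[of x 1]) auto
    have "filterlim (\<lambda>y. y / (1 - y)) (at_right (x / (1 - x))) (at_right x)"
      unfolding filterlim_at
    proof (intro conjI)
      show "eventually (\<lambda>y. y / (1 - y) \<in> {x / (1 - x)<..} \<and> y / (1 - y) \<noteq> x / (1 - x)) (at_right x)"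
        using less by eventually_elim (simp add: field_simps)
    qed (use False in \<open>auto intro!: tendsto_intros\<close>)
    then have "eventually (\<lambda>y. CW_F (y / (1 - y)) \<le> CW_F (x / (1 - x)) + c) (at_right x)"
      using IH[of "x / (1 - x)"] False Suc.prems by (auto simp: filterlim_iff)
    with less show ?thesis
    proof eventually_elim
      case (elim y)
      then have xy: "0 \<le> y" "x < 1" using False Suc.prems by linarith+
      show ?case
        using elim(2) conjunct2[OF elim(1)] CW_F_lt_1[OF Suc.prems xy(2)] CW_F_lt_1[OF xy(1)] unfolding c by simp
    qed
  qed
qed

lemma CW_F_continuous_at_right: "continuous (at_right x) CW_F"
proof (cases "x \<ge> 0")
  case True
  show ?thesis
    unfolding continuous_within
  proof (rule order_tendstoI)
    fix a assume a: "a < CW_F x"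
    show "eventually (\<lambda>y. a < CW_F y) (at_right x)"
      using eventually_at_right_less[of x]
      by eventually_elim (use a CW_F_mono in \<open>meson less_imp_le less_le_trans\<close>)
  next
    fix a assume "CW_F x < a"
    then obtain n where "(1 / 2 :: real) ^ n < a - CW_F x"
      using real_arch_pow_inv[of "a - CW_F x" "1 / 2"] by auto
    then have n: "CW_F x + 1 / 2 ^ n < a"
      by (simp add: power_divide)
    show "eventually (\<lambda>y. CW_F y < a) (at_right x)"
      using CW_F_right_oscillation[OF True, of n] by eventually_elim (use n in linarith)
  qed
next
  case False
  have "eventually (\<lambda>y. CW_F y = 0) (at_right x)"
    using False by (intro eventually_at_rightI[of x 0]) (auto simp: CW_F_def)
  moreover have "CW_F x = 0"
    using False by (simp add: CW_F_def)
  ultimately show ?thesis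
    by (simp add: continuous_within tendsto_eventually)
qed

lemma CW_F_tendsto_at_bot: "(CW_F \<longlongrightarrow> 0) at_bot"
proof (rule tendsto_eventually)
  show "eventually (\<lambda>x. CW_F x = 0) at_bot"
    using eventually_gt_at_bot[of "0 :: real"] by eventually_elim (simp add: CW_F_def)
qed

lemma CW_F_of_nat: "CW_F (real n) = 1 - 1 / 2 ^ n"
proof (induction n)
  case (Suc n)
  have "CW_F (real (Suc n)) = (1 + CW_F (real n)) / 2"
    using CW_F_add_1[of "real n"] by (simp only: of_nat_Suc add.commute)
  then show ?case unfolding Suc by (simp add: field_simps)
qed (simp add: CW_F_0)

lemma CW_F_tendsto_at_top: "(CW_F \<longlongrightarrow> 1) at_top"
proof (rule order_tendstoI)
  fix a :: real assume "a < 1"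
  then obtain n where n: "(1 / 2 :: real) ^ n < 1 - a"
    using real_arch_pow_inv[of "1 - a" "1 / 2"] by auto
  show "eventually (\<lambda>x. a < CW_F x) at_top"
    using eventually_ge_at_top[of "real n"]
    by eventually_elim (use n CW_F_mono[of "real n"] CW_F_of_nat[of n] in \<open>force simp: power_divide\<close>)
next
  fix a :: real assume "1 < a"
  then show "eventually (\<lambda>x. CW_F x < a) at_top"
    by (auto intro!: always_eventually intro: le_less_trans[OF CW_F_le_1])
qed

subsection \<open>Self-similarity of the measure\<close>

abbreviation CW_measure :: "real measure" where
  "CW_measure \<equiv> interval_measure CW_F"

interpretation CW: real_distribution CW_measure
  by (rule real_distribution_interval_measure)
     (simp_all add: CW_F_mono CW_F_continuous_at_right CW_F_tendsto_at_bot CW_F_tendsto_at_top)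

lemma measure_CW_Iic: "measure CW_measure {..x} = CW_F x"
  by (rule measure_interval_measure_Iic)
     (simp_all add: CW_F_mono CW_F_continuous_at_right CW_F_tendsto_at_bot)

lemma emeasure_CW_Iic: "emeasure CW_measure {..x} = CW_F x"
  by (simp add: CW.emeasure_eq_measure measure_CW_Iic)

text \<open>Since F vanishes at 0, integrals over \<open>{0..}\<close> and over the whole line
  coincide, and \<open>squash x\<close> may replace \<open>x / (x + 1)\<close>.\<close>

lemma AE_CW_pos: "AE x in CW_measure. x > 0"
proof (rule AE_I[where N = "{..0}"])
  show "emeasure CW_measure {..0} = 0"
    by (simp add: emeasure_CW_Iic CW_F_0)
qed auto

text \<open>
  On \<open>x \<ge> 0\<close> this is \<open>x / (x + 1)\<close>; the absolute value only removes the pole at \<open>- 1\<close>, so that the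
  map is strictly increasing on the whole line.
\<close>

definition squash :: "real \<Rightarrow> real" where
  "squash x = x / (\<bar>x\<bar> + 1)"

lemma squash_measurable [measurable]: "squash \<in> borel_measurable borel"
  unfolding squash_def by measurable

lemma squash_lt_1: "squash x < 1"
  by (simp add: squash_def divide_less_eq add_increasing2 abs_if)

lemma squash_le_iff:
  assumes "0 \<le> a" "a < 1"
  shows "squash x \<le> a \<longleftrightarrow> x \<le> a / (1 - a)"
proof (cases "x \<ge> 0")
  case True
  then show ?thesis
    using assms by (simp add: squash_def field_simps)
next
  case False
  then have "squash x \<le> 0" "x \<le> 0" "a / (1 - a) \<ge> 0"
    using assms by (simp_all add: squash_def divide_nonpos_pos)
  then show ?thesis using assms by linarith
qed

lemma squash_less_0_iff: "squash x < 0 \<longleftrightarrow> x < 0"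
  by (auto simp: squash_def divide_less_0_iff)

text \<open>A constant of its own, since the simplifier rewrites \<open>ennreal (1 / 2)\<close> to \<open>inverse 2\<close>.\<close>

definition ehalf :: ennreal where
  "ehalf = ennreal (1 / 2)"

lemma ehalf_mult: "x \<ge> 0 \<Longrightarrow> ehalf * ennreal x = ennreal (x / 2)"
  unfolding ehalf_def by (subst ennreal_mult[symmetric]) simp_all

lemma ehalf_not_top: "ehalf \<noteq> \<top>"
  by (simp add: ehalf_def)

text \<open>Finite Borel measures on the line are determined by their cdfs. For
  \<open>a >= 1\<close> equality of the cdfs reads \<open>CW_F a - 1/2 = CW_F (a - 1) / 2\<close>,
  the first functional equation; for \<open>a < 1\<close> both vanish.\<close>

lemma CW_measure_greater_1:
  "density CW_measure (indicator {1<..}) =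
     density (distr CW_measure borel (\<lambda>x. x + 1)) (\<lambda>_. ehalf)"
  (is "?M1 = ?M2")
proof (rule cdf_unique')
  have em1: "emeasure ?M1 A = emeasure CW_measure (A \<inter> {1<..})" if "A \<in> sets borel" for A
    using that by (simp add: emeasure_restricted Int_commute)
  have em2: "emeasure ?M2 A = ehalf * emeasure CW_measure ((\<lambda>x. x + 1) -` A)"
    if "A \<in> sets borel" for A
    using that by (simp add: emeasure_density_const emeasure_distr)
  have "finite_measure ?M1"
    using em1[of UNIV] by (intro finite_measureI) simp
  then show "finite_borel_measure ?M1"
    by (simp add: finite_borel_measure_def finite_borel_measure_axioms_def)
  have "finite_measure ?M2"
    using em2[of UNIV] by (intro finite_measureI) (simp add: ennreal_mult_eq_top_iff ehalf_not_top)
  then show "finite_borel_measure ?M2"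
    by (simp add: finite_borel_measure_def finite_borel_measure_axioms_def)
  have "emeasure ?M1 {..a} = emeasure ?M2 {..a}" for a
  proof (cases "a \<ge> 1")
    case True
    have "{..a} \<inter> {1<..} = {1<..a}" by auto
    then have "emeasure ?M1 {..a} = ennreal (CW_F a - CW_F 1)"
      using True by (simp add: em1 emeasure_interval_measure_Ioc CW_F_mono CW_F_continuous_at_right)
    moreover have "(\<lambda>x. x + 1) -` {..a} = {..a - 1}" by auto
    then have "emeasure ?M2 {..a} = ennreal (CW_F (a - 1) / 2)"
      by (simp add: em2 emeasure_CW_Iic CW_F_nonneg ehalf_mult)
    ultimately show ?thesis
      using CW_F_ge_1[OF True] by (simp add: CW_F_1 add_divide_distrib)
  next
    case False
    have "{..a} \<inter> {1<..} = {}" using False by auto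
    moreover have "(\<lambda>x. x + 1) -` {..a} = {..a - 1}" by auto
    ultimately show ?thesis
      using False by (simp add: em1 em2 emeasure_CW_Iic CW_F_def)
  qed
  then show "cdf ?M1 = cdf ?M2"
    by (simp add: cdf_def fun_eq_iff measure_def)
qed

text \<open>The cdfs are compared again: on [0,1) they agree by the second functional equation, and
  from 1 onwards both equal 1/2.\<close>

lemma CW_measure_atMost_1:
  "density CW_measure (indicator {..1}) =
     density (distr CW_measure borel squash) (\<lambda>_. ehalf)"
  (is "?M1 = ?M2")
proof (rule cdf_unique')
  have em1: "emeasure ?M1 A = emeasure CW_measure (A \<inter> {..1})" if "A \<in> sets borel" for A
    using that by (simp add: emeasure_restricted Int_commute)
  have em2: "emeasure ?M2 A = ehalf * emeasure CW_measure (squash -` A)"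
    if "A \<in> sets borel" for A
    using that by (simp add: emeasure_density_const emeasure_distr)
  have "finite_measure ?M1"
    using em1[of UNIV] by (intro finite_measureI) simp
  then show "finite_borel_measure ?M1"
    by (simp add: finite_borel_measure_def finite_borel_measure_axioms_def)
  have "finite_measure ?M2"
    using em2[of UNIV] by (intro finite_measureI) (simp add: ennreal_mult_eq_top_iff ehalf_not_top)
  then show "finite_borel_measure ?M2"
    by (simp add: finite_borel_measure_def finite_borel_measure_axioms_def)
  have "emeasure ?M1 {..a} = emeasure ?M2 {..a}" for a
  proof -
    have M1: "emeasure ?M1 {..a} = ennreal (CW_F (min a 1))"
    proof -
      have "{..a} \<inter> {..1} = {..min a 1}" by auto
      then show ?thesis by (simp add: em1 emeasure_CW_Iic)
    qed
    consider "a < 0" | "0 \<le> a" "a < 1" | "a \<ge> 1" by linarith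
    then show ?thesis
    proof cases
      case 1
      \<comment> \<open>For negative \<open>a\<close> the preimage lies in a null set because
        \<open>CW_F 0 = 0\<close>.\<close>
      have "squash -` {..a} \<subseteq> {..0}"
        using 1 squash_less_0_iff by (force simp: less_le)
      then have "emeasure CW_measure (squash -` {..a}) \<le> emeasure CW_measure {..0}"
        by (intro emeasure_mono) auto
      then show ?thesis
        unfolding M1 using 1 by (simp add: em2 emeasure_CW_Iic CW_F_0) (simp add: CW_F_def)
    next
      case 2
      have "squash -` {..a} = {..a / (1 - a)}"
        using squash_le_iff[OF 2] by auto
      then show ?thesis
        unfolding M1 using 2 CW_F_lt_1[OF 2]
        by (simp add: em2 emeasure_CW_Iic CW_F_nonneg ehalf_mult)
    next
      case 3
      have "squash -` {..a} = UNIV"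
        using 3 less_le_trans[OF squash_lt_1] by (auto intro: less_imp_le)
      then show ?thesis
        unfolding M1 using 3 CW.emeasure_space_1 ehalf_mult[of 1] by (simp add: em2 CW_F_1)
    qed
  qed
  then show "cdf ?M1 = cdf ?M2"
    by (simp add: cdf_def fun_eq_iff measure_def)
qed

text \<open>Splitting at 1 and inserting the two image descriptions. The nonnegative integral makes
  this available before any integrability is known.\<close>

lemma nn_integral_CW:
  assumes [measurable]: "f \<in> borel_measurable borel"
  shows "(\<integral>\<^sup>+x. f x \<partial>CW_measure) =
           ehalf * (\<integral>\<^sup>+x. f (squash x) \<partial>CW_measure) +
           ehalf * (\<integral>\<^sup>+x. f (x + 1) \<partial>CW_measure)"
proof -
  have "(\<integral>\<^sup>+x. f x \<partial>CW_measure) =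
          (\<integral>\<^sup>+x. indicator {..1} x * f x + indicator {1<..} x * f x \<partial>CW_measure)"
    by (intro nn_integral_cong) (auto simp: indicator_def)
  also have "\<dots> = (\<integral>\<^sup>+x. indicator {..1} x * f x \<partial>CW_measure) +
                  (\<integral>\<^sup>+x. indicator {1<..} x * f x \<partial>CW_measure)"
    by (rule nn_integral_add) measurable
  also have "(\<integral>\<^sup>+x. indicator {..1} x * f x \<partial>CW_measure) =
               (\<integral>\<^sup>+x. f x \<partial>density CW_measure (indicator {..1}))"
    by (simp add: nn_integral_density)
  also have "\<dots> = ehalf * (\<integral>\<^sup>+x. f (squash x) \<partial>CW_measure)"
    unfolding CW_measure_atMost_1
    by (simp add: nn_integral_density nn_integral_cmult nn_integral_distr)
  also have "(\<integral>\<^sup>+x. indicator {1<..} x * f x \<partial>CW_measure) =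
               (\<integral>\<^sup>+x. f x \<partial>density CW_measure (indicator {1<..}))"
    by (simp add: nn_integral_density)
  also have "\<dots> = ehalf * (\<integral>\<^sup>+x. f (x + 1) \<partial>CW_measure)"
    unfolding CW_measure_greater_1
    by (simp add: nn_integral_density nn_integral_cmult nn_integral_distr)
  finally show ?thesis .
qed

section \<open>Exponential integrability and the moments\<close>

text \<open>
  The truncation keeps the integrals finite, so that the contraction factor
  \<open>exp c / 2 < 1\<close> yields a bound independent of it.
\<close>

lemma integrable_exp_CW:
  assumes "0 \<le> c" "exp c < 2"
  shows "integrable CW_measure (\<lambda>x. exp (c * x))"
proof -
  \<comment> \<open>The fixed point of \<open>I = exp c / 2 + exp c * I / 2\<close>, the extreme
    case of the inequality derived below.\<close>
  define B where "B = exp c / (2 - exp c)"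
  have bound: "(\<integral>\<^sup>+x. ennreal (exp (c * min x (real n))) \<partial>CW_measure) \<le> ennreal B" for n
  proof -
    define g where "g = (\<lambda>x. exp (c * min x (real n)))"
    have g_meas [measurable]: "g \<in> borel_measurable borel"
      unfolding g_def by measurable
    have g_le: "g x \<le> exp (c * real n)" for x
      using assms by (auto simp: g_def intro!: mult_left_mono)
    have int: "integrable CW_measure g"
      by (rule CW.integrable_const_bound[where B = "exp (c * real n)"])
         (use g_le in \<open>auto simp: g_def\<close>)
    define I where "I = (\<integral>x. g x \<partial>CW_measure)"
    have I: "(\<integral>\<^sup>+x. ennreal (g x) \<partial>CW_measure) = ennreal I"
      unfolding I_def by (rule nn_integral_eq_integral[OF int]) (auto simp: g_def)
    have I_nonneg: "I \<ge> 0"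
      unfolding I_def by (rule integral_nonneg_AE) (auto simp: g_def)
    have "g (squash x) \<le> exp c" for x
    proof -
      have "min (squash x) (real n) \<le> 1" using squash_lt_1[of x] by auto
      then have "c * min (squash x) (real n) \<le> c * 1"
        by (rule mult_left_mono) (use assms in auto)
      then show ?thesis by (simp add: g_def)
    qed
    then have "(\<integral>\<^sup>+x. ennreal (g (squash x)) \<partial>CW_measure) \<le> (\<integral>\<^sup>+x. ennreal (exp c) \<partial>CW_measure)"
      by (intro nn_integral_mono) (auto intro: ennreal_leI)
    then have 1: "(\<integral>\<^sup>+x. ennreal (g (squash x)) \<partial>CW_measure) \<le> ennreal (exp c)"
      using CW.emeasure_space_1 by simp
    have "g (x + 1) \<le> exp c * g x" for x
    proof -
      have "min (x + 1) (real n) \<le> min x (real n) + 1" by auto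
      then have "c * min (x + 1) (real n) \<le> c * (min x (real n) + 1)"
        by (rule mult_left_mono) (use assms in auto)
      then show ?thesis by (simp add: g_def algebra_simps flip: exp_add)
    qed
    then have "(\<integral>\<^sup>+x. ennreal (g (x + 1)) \<partial>CW_measure) \<le>
                 (\<integral>\<^sup>+x. ennreal (exp c) * ennreal (g x) \<partial>CW_measure)"
      by (intro nn_integral_mono) (auto intro: ennreal_leI simp: g_def simp flip: ennreal_mult)
    also have "\<dots> = ennreal (exp c * I)"
      using I_nonneg by (simp add: nn_integral_cmult I ennreal_mult)
    finally have 2: "(\<integral>\<^sup>+x. ennreal (g (x + 1)) \<partial>CW_measure) \<le> ennreal (exp c * I)" .
    have "ennreal I \<le> ehalf * ennreal (exp c) + ehalf * ennreal (exp c * I)"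
      using nn_integral_CW[of "\<lambda>x. ennreal (g x)"] 1 2
      by (auto simp: I intro!: add_mono mult_left_mono)
    also have "\<dots> = ennreal (exp c / 2 + exp c * I / 2)"
      using I_nonneg by (simp add: ehalf_mult flip: ennreal_plus)
    finally have "I \<le> exp c / 2 + exp c * I / 2"
      using I_nonneg by (subst (asm) ennreal_le_iff) auto
    then have "I \<le> B"
      using assms by (simp add: B_def pos_le_divide_eq algebra_simps)
    then show ?thesis
      using I by (auto simp: g_def intro: ennreal_leI)
  qed
  have lim: "(\<lambda>n. ennreal (exp (c * min x (real n)))) \<longlonglongrightarrow> ennreal (exp (c * x))" for x
  proof (rule tendsto_eventually)
    show "eventually (\<lambda>n. ennreal (exp (c * min x (real n))) = ennreal (exp (c * x))) sequentially"
      using eventually_ge_at_top[of "nat \<lceil>x\<rceil>"]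
      by eventually_elim (simp add: min_def nat_le_iff ceiling_le_iff)
  qed
  \<comment> \<open>Fatou's lemma removes the truncation, since at each point the truncated
    integrands are eventually constant.\<close>
  have "(\<integral>\<^sup>+x. ennreal (exp (c * x)) \<partial>CW_measure) =
          (\<integral>\<^sup>+x. liminf (\<lambda>n. ennreal (exp (c * min x (real n)))) \<partial>CW_measure)"
    by (intro nn_integral_cong lim_imp_Liminf[symmetric] lim) simp
  also have "\<dots> \<le> liminf (\<lambda>n. (\<integral>\<^sup>+x. ennreal (exp (c * min x (real n))) \<partial>CW_measure))"
    by (rule nn_integral_liminf) measurable
  also have "\<dots> \<le> ennreal B"
    by (rule Liminf_le) (use bound in auto)
  finally show ?thesis
    by (intro integrableI_bounded) (auto simp: top.extremum_unique less_top[symmetric] top_unique)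
qed

lemma integrable_power_CW: "integrable CW_measure (\<lambda>x. x ^ k)"
proof -
  \<comment> \<open>Any \<open>c\<close> strictly between 0 and \<open>ln 2\<close> would do; here
    the condition reduces to e <= 3 < 4.\<close>
  define c :: real where "c = 1 / 2"
  have "exp (1 / 2 :: real) ^ 2 < 2 ^ 2"
    using exp_le by (simp flip: exp_double)
  then have "exp (1 / 2 :: real) < 2"
    by (rule power_less_imp_less_base) simp
  then have c: "0 < c" "exp c < 2" by (simp_all add: c_def)
  have int: "integrable CW_measure (\<lambda>x. fact k / c ^ k * exp (c * x))"
    using integrable_exp_CW[of c] c by simp
  show ?thesis
  proof (rule Bochner_Integration.integrable_bound[OF int])
    show "AE x in CW_measure. norm (x ^ k) \<le> norm (fact k / c ^ k * exp (c * x))"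
      using AE_CW_pos
    proof eventually_elim
      case (elim x)
      \<comment> \<open>For positive \<open>x\<close> a single Taylor term is at most the whole
        exponential series.\<close>
      then have "(c * x) ^ k / fact k \<le> exp (c * x)"
        using c sum_le_suminf[OF summable_exp, of "{k}" "c * x"]
        by (simp add: exp_def divide_inverse mult.commute summable_exp_generic)
      then show ?case
        using elim c by (simp add: field_simps power_mult_distrib)
    qed
  qed measurable
qed

lemma CW_M_eq: "CW_M k = (\<integral>x. x ^ k \<partial>CW_measure)"
  unfolding CW_M_def set_lebesgue_integral_def
proof (rule integral_cong_AE)
  show "AE x in CW_measure. indicator {0..} x *\<^sub>R x ^ k = x ^ k"
    using AE_CW_pos by eventually_elim simp
qed measurable

lemma CW_m_eq: "CW_m k = (\<integral>x. squash x ^ k \<partial>CW_measure)"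
  unfolding CW_m_def set_lebesgue_integral_def
proof (rule integral_cong_AE)
  show "AE x in CW_measure. indicator {0..} x *\<^sub>R (x / (x + 1)) ^ k = squash x ^ k"
    using AE_CW_pos by eventually_elim (simp add: squash_def)
qed measurable

lemma abs_CW_m_le_1: "\<bar>CW_m k\<bar> \<le> 1"
proof -
  have "\<bar>squash x ^ k\<bar> \<le> 1" for x
    by (simp add: squash_def power_abs power_le_one_iff divide_le_eq)
  then have "norm (\<integral>x. squash x ^ k \<partial>CW_measure) \<le> (\<integral>x. 1 \<partial>CW_measure)"
    by (intro Bochner_Integration.integral_norm_bound_integral CW.integrable_const_bound[where B = 1]) auto
  then show ?thesis by (simp add: CW_m_eq CW.prob_space[simplified])
qed

text \<open>On the part up to 1 the power becomes a power of \<open>squash\<close>; on the part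
  above 1 it becomes \<open>(x + 1) ^ n\<close>, which is expanded binomially. The summand
  \<open>k = n\<close> is \<open>CW_M n\<close> itself, which accounts for the 2 in
  \<open>2 - exp t\<close>.\<close>

lemma CW_M_rec: "CW_M n = CW_m n / 2 + (\<Sum>k\<le>n. real (n choose k) * CW_M k) / 2"
proof -
  note int = integrable_power_CW[of n]
  have half: "(\<integral>x. x ^ n \<partial>density (distr CW_measure borel h) (\<lambda>_. ehalf)) =
                (\<integral>x. h x ^ n \<partial>CW_measure) / 2"
    if [measurable]: "h \<in> borel_measurable borel" for h :: "real \<Rightarrow> real"
    unfolding ehalf_def by (subst integral_density) (auto simp: integral_distr)
  have "CW_M n = (\<integral>x. indicator {..1} x * x ^ n + indicator {1<..} x * x ^ n \<partial>CW_measure)"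
    unfolding CW_M_eq by (intro Bochner_Integration.integral_cong) (auto simp: indicator_def)
  also have "\<dots> = (\<integral>x. indicator {..1} x * x ^ n \<partial>CW_measure) +
                  (\<integral>x. indicator {1<..} x * x ^ n \<partial>CW_measure)"
    using integrable_real_mult_indicator[OF _ int, of "{..1}"]
      integrable_real_mult_indicator[OF _ int, of "{1<..}"]
    by (intro Bochner_Integration.integral_add) (simp_all add: mult.commute)
  also have "(\<integral>x. indicator {..1} x * x ^ n \<partial>CW_measure) =
               (\<integral>x. x ^ n \<partial>density CW_measure (indicator {..1}))"
    using integral_density[of "\<lambda>x. x ^ n" CW_measure "indicator {..1}"] by (simp add: ennreal_indicator)
  also have "\<dots> = CW_m n / 2"
    unfolding CW_measure_atMost_1 CW_m_eq by (rule half) measurable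
  also have "(\<integral>x. indicator {1<..} x * x ^ n \<partial>CW_measure) =
               (\<integral>x. x ^ n \<partial>density CW_measure (indicator {1<..}))"
    using integral_density[of "\<lambda>x. x ^ n" CW_measure "indicator {1<..}"] by (simp add: ennreal_indicator)
  also have "\<dots> = (\<integral>x. (x + 1) ^ n \<partial>CW_measure) / 2"
    unfolding CW_measure_greater_1 by (rule half) measurable
  also have "(\<integral>x. (x + 1) ^ n \<partial>CW_measure) = (\<Sum>k\<le>n. real (n choose k) * CW_M k)"
    unfolding CW_M_eq by (simp add: binomial_ring integrable_power_CW)
  finally show ?thesis .
qed

subsection \<open>The generating function of the moments\<close>

text \<open>A formal series lets the recursion become an algebraic identity before convergence of
  the moment series is known.\<close>

definition CW_M_fps :: "complex fps" where
  "CW_M_fps = Abs_fps (\<lambda>n. of_real (CW_M n / fact n))"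

definition CW_m_fps :: "complex fps" where
  "CW_m_fps = Abs_fps (\<lambda>n. of_real (CW_m n / fact n))"

text \<open>This is the recursion \<open>CW_M_rec\<close> divided by \<open>n!\<close>, i.e. \<open>M(t) (2 - exp t) = m(t)\<close>.\<close>

lemma CW_M_fps_eq: "CW_M_fps = CW_m_fps / (2 - fps_exp 1)"
proof -
  have "CW_M n / fact n = CW_m n / fact n / 2 + (\<Sum>i\<le>n. CW_M i / fact i * (1 / fact (n - i))) / 2" for n
  proof -
    have "(\<Sum>k\<le>n. real (n choose k) * CW_M k) / fact n = (\<Sum>i\<le>n. CW_M i / fact i * (1 / fact (n - i)))"
      unfolding sum_divide_distrib
      by (intro sum.cong) (simp_all add: binomial_fact field_simps)
    then show ?thesis
      by (subst CW_M_rec) (simp add: add_divide_distrib)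
  qed
  then have "2 * (CW_M n / fact n) - (\<Sum>i\<le>n. CW_M i / fact i * (1 / fact (n - i))) = CW_m n / fact n" for n
    by (simp add: field_simps)
  then have "complex_of_real (2 * (CW_M n / fact n) - (\<Sum>i\<le>n. CW_M i / fact i * (1 / fact (n - i)))) =
               of_real (CW_m n / fact n)" for n
    by (rule arg_cong)
  moreover have "fps_nth (CW_M_fps * (2 - fps_exp 1)) n = 2 * fps_nth CW_M_fps n - fps_nth (CW_M_fps * fps_exp 1) n" for n
    by (simp only: right_diff_distrib mult_2_right fps_sub_nth fps_add_nth mult_2)
  ultimately have "CW_M_fps * (2 - fps_exp 1) = CW_m_fps"
    by (intro fps_ext) (simp add: fps_mult_nth CW_M_fps_def CW_m_fps_def atMost_atLeast0)
  moreover have "fps_nth (2 - fps_exp 1 :: complex fps) 0 \<noteq> 0"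
    by simp
  then have "(2 - fps_exp 1 :: complex fps) \<noteq> 0"
    by (metis fps_zero_nth)
  ultimately show ?thesis
    by (metis nonzero_mult_div_cancel_right)
qed

text \<open>As \<open>CW_m k\<close> is bounded by 1, the exponential series is a majorant for every
  radius; hence m is entire.\<close>

lemma summable_CW_m_gf: "summable (\<lambda>k. norm (CW_m k / fact k) * r ^ k)" if "r \<ge> 0"
proof (rule summable_comparison_test')
  show "summable (\<lambda>k. inverse (fact k) * r ^ k)"
    by (rule summable_exp)
  show "norm (norm (CW_m k / fact k) * r ^ k) \<le> inverse (fact k) * r ^ k" for k
    using abs_CW_m_le_1[of k] that
    by (simp add: abs_mult divide_simps mult_left_le_one_le)
qed

lemma fps_conv_radius_CW_m: "fps_conv_radius CW_m_fps = \<infinity>"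
  unfolding fps_conv_radius_def
proof (rule conv_radius_inftyI'')
  fix z :: complex
  show "summable (\<lambda>n. fps_nth CW_m_fps n * z ^ n)"
    by (rule summable_norm_cancel)
       (use summable_CW_m_gf[of "norm z"] in \<open>simp add: CW_m_fps_def norm_mult norm_power norm_divide\<close>)
qed

lemma eval_CW_m_fps: "eval_fps CW_m_fps (of_real t) = of_real (CW_m_gf t)"
proof -
  have "summable (\<lambda>k. (CW_m k / fact k) *\<^sub>R t ^ k)"
    by (rule summable_norm_cancel) (use summable_CW_m_gf[of "\<bar>t\<bar>"] in \<open>simp add: abs_mult power_abs\<close>)
  then show ?thesis
    unfolding eval_fps_def CW_m_gf_def CW_m_fps_def
    by (subst suminf_of_real) simp_all
qed

section \<open>The dominant pole and the asymptotics of the moments\<close>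

text \<open>The solutions are \<open>ln 2 + 2 pi i n\<close>, and those with \<open>n = 1\<close>
  and \<open>n = -1\<close> lie exactly on the excluded circle.\<close>

lemma exp_eq_2_imp:
  fixes z :: complex
  assumes "exp z = 2" "norm z < sqrt (4 * pi\<^sup>2 + (ln 2)\<^sup>2)"
  shows "z = of_real (ln 2)"
proof -
  have "exp z = exp (of_real (ln 2))"
    using assms(1) by (simp add: exp_of_real)
  then obtain n :: int where n: "z = of_real (ln 2) + (of_int (2 * n) * pi) * \<i>"
    using exp_eq by auto
  have "(norm z)\<^sup>2 = (ln 2)\<^sup>2 + 4 * (of_int n)\<^sup>2 * pi\<^sup>2"
    unfolding n cmod_power2 by (simp add: power_mult_distrib)
  moreover have "(norm z)\<^sup>2 < 4 * pi\<^sup>2 + (ln 2)\<^sup>2"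
    using power_strict_mono[OF assms(2), of 2] by simp
  ultimately have "(of_int n)\<^sup>2 * pi\<^sup>2 < 1 * pi\<^sup>2" by simp
  then have "(real_of_int n)\<^sup>2 < 1"
    using mult_less_cancel_right_pos[of "pi\<^sup>2"] by simp
  then have "\<bar>real_of_int n\<bar> < 1"
    by (simp add: abs_square_less_1)
  then have "n = 0" by linarith
  with n show ?thesis by simp
qed

lemma CW_M_asymptotics:
  assumes r: "0 < r" "r < sqrt (4 * pi\<^sup>2 + (ln 2)\<^sup>2)"
  shows "\<exists>C. \<forall>n. \<bar>CW_M n / fact n - CW_m_gf (ln 2) / (2 * ln 2) * (1 / ln 2) ^ n\<bar> \<le> C / r ^ n"
proof -
  define R where "R = sqrt (4 * pi\<^sup>2 + (ln 2)\<^sup>2)"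
  define S where "S = ball (0 :: complex) R"
  define l :: complex where "l = of_real (ln 2)"
  have exp_l: "exp l = 2" by (simp add: l_def exp_of_real)
  have "ln 2 < R"
    unfolding R_def by (rule real_less_rsqrt) simp
  then have l: "l \<in> interior S" "l \<noteq> 0"
    by (simp_all add: S_def l_def)
  define m where "m = eval_fps CW_m_fps"
  \<comment> \<open>The holomorphic extension of \<open>(2 - exp z) / (z - l)\<close>. It has no
    zero on \<open>S\<close>: at \<open>l\<close> its value is the derivative -2, so the pole is
    simple.\<close>
  define h where "h = (\<lambda>z. if z = l then deriv (\<lambda>z. 2 - exp z) l else ((2 - exp z) - (2 - exp l)) / (z - l))"
  have "h holomorphic_on S"
    unfolding h_def by (intro pole_lemma l holomorphic_intros)
  have "((\<lambda>z. 2 - exp z) has_field_derivative -2) (at l)"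
    by (auto intro!: derivative_eq_intros simp: exp_l)
  then have h_l: "h l = -2"
    by (simp add: h_def DERIV_imp_deriv)
  have h_nz: "h z \<noteq> 0" if "z \<in> S" for z
  proof (cases "z = l")
    case False
    then have "2 - exp z \<noteq> 0"
      using exp_eq_2_imp[of z, folded l_def R_def] that by (auto simp: S_def)
    with False show ?thesis
      unfolding h_def exp_l by simp
  qed (simp add: h_l)
  define F where "F = (\<lambda>z. m z / h z)"
  have "F holomorphic_on S"
    unfolding F_def m_def
    by (intro holomorphic_intros \<open>h holomorphic_on S\<close> h_nz) (auto simp: fps_conv_radius_CW_m)
  \<comment> \<open>With \<open>F z / (z - l)\<close> equal to the generating function, this
    difference quotient of \<open>F\<close> is that function minus its principal part
    \<open>F l / (z - l)\<close>, with the singularity at \<open>l\<close> filled in.\<close>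
  define G where "G = (\<lambda>z. if z = l then deriv F l else (F z - F l) / (z - l))"
  have G_holo: "G holomorphic_on S"
    unfolding G_def by (intro pole_lemma l \<open>F holomorphic_on S\<close>)

  \<comment> \<open>Since \<open>F l = - m l / 2\<close>, the principal part equals
    \<open>K / (1 - z / l)\<close>, a geometric series with coefficients \<open>K / l ^ n\<close>:
    the main term.\<close>
  define K where "K = m l / (2 * l)"
  have G_eq: "G z = m z / (2 - exp z) - K * (1 / (1 - 1 / l * z))" if "z \<in> S" "z \<noteq> l" for z
  proof -
    have "exp z \<noteq> 2"
      using exp_eq_2_imp[of z, folded l_def R_def] that by (auto simp: S_def)
    then have "F z / (z - l) = m z / (2 - exp z)"
      using that by (simp add: F_def h_def exp_l)
    moreover have "F l / (z - l) = K * (1 / (1 - 1 / l * z))"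
      using that l(2) by (simp add: F_def h_l K_def field_simps)
    ultimately show ?thesis
      using that by (simp add: G_def diff_divide_distrib)
  qed
  have m_fps: "m has_fps_expansion CW_m_fps"
    unfolding m_def by (intro eval_fps_has_fps_expansion) (simp add: fps_conv_radius_CW_m)
  have geo_fps: "(\<lambda>z. 1 / (1 - 1 / l * z)) has_fps_expansion Abs_fps (\<lambda>n. (1 / l) ^ n)"
  proof (rule has_fps_expansionI)
    have "eventually (\<lambda>z. z \<in> ball 0 (norm l)) (nhds 0)"
      using l(2) by (intro eventually_nhds_in_open) auto
    then show "eventually (\<lambda>u. (\<lambda>n. fps_nth (Abs_fps (\<lambda>n. (1 / l) ^ n)) n * u ^ n) sums (1 / (1 - 1 / l * u))) (nhds 0)"
    proof eventually_elim
      case (elim u)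
      then have "norm (1 / l * u) < 1" using l(2) by (simp add: norm_divide)
      from geometric_sums[OF this] show ?case by (simp add: power_divide)
    qed
  qed
  have fps: "(\<lambda>z. m z / (2 - exp z) - K * (1 / (1 - 1 / l * z))) has_fps_expansion
          (CW_m_fps / (2 - fps_exp 1) - fps_const K * Abs_fps (\<lambda>n. (1 / l) ^ n))"
    by (intro fps_expansion_intros m_fps geo_fps) simp
  have "eventually (\<lambda>z. z \<in> S - {l}) (nhds 0)"
    using l(2) less_trans[OF ln_gt_zero \<open>ln 2 < R\<close>] by (intro eventually_nhds_in_open) (auto simp: S_def open_delete)
  then have ev: "eventually (\<lambda>z. m z / (2 - exp z) - K * (1 / (1 - 1 / l * z)) = G z) (nhds 0)"
    by eventually_elim (simp add: G_eq)
  have "G has_fps_expansion (CW_M_fps - fps_const K * Abs_fps (\<lambda>n. (1 / l) ^ n))"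
    unfolding CW_M_fps_eq by (rule iffD1[OF has_fps_expansion_cong[OF ev refl] fps])
  \<comment> \<open>The Taylor coefficients of \<open>G\<close> are exactly the error terms to be
    bounded.\<close>
  then have coeff: "(deriv ^^ n) G 0 / fact n = of_real (CW_M n / fact n) - K * (1 / l) ^ n" for n
    by (subst fps_nth_fps_expansion[symmetric], assumption)
       (simp only: fps_sub_nth fps_mult_left_const_nth CW_M_fps_def fps_nth_Abs_fps)
  have K: "K = of_real (CW_m_gf (ln 2) / (2 * ln 2))"
    by (simp add: K_def m_def l_def eval_CW_m_fps)

  \<comment> \<open>The strict bound on \<open>r\<close> keeps the closed disc inside
    \<open>S\<close>, so compactness bounds \<open>G\<close> there and Cauchy's inequality
    applies.\<close>
  have sub: "cball 0 r \<subseteq> S" using r by (auto simp: S_def R_def)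
  have cont: "continuous_on (cball 0 r) G"
    using G_holo sub holomorphic_on_imp_continuous_on holomorphic_on_subset by blast
  then have "bounded (G ` cball 0 r)"
    by (intro compact_imp_bounded compact_continuous_image) auto
  then obtain C where C: "\<forall>z\<in>cball 0 r. norm (G z) \<le> C"
    by (auto simp: bounded_iff)
  have "\<bar>CW_M n / fact n - CW_m_gf (ln 2) / (2 * ln 2) * (1 / ln 2) ^ n\<bar> \<le> C / r ^ n" for n
  proof -
    have "norm ((deriv ^^ n) G 0) \<le> fact n * C / r ^ n"
    proof (rule Cauchy_inequality[OF _ cont r(1)])
      show "G holomorphic_on ball 0 r"
        using sub by (intro holomorphic_on_subset[OF G_holo]) auto
      show "norm (G z) \<le> C" if "norm (0 - z) = r" for z
        using C that by simp
    qed
    then have "norm ((deriv ^^ n) G 0 / fact n) \<le> C / r ^ n"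
      by (simp add: norm_divide field_simps)
    also have "(deriv ^^ n) G 0 / fact n =
                 of_real (CW_M n / fact n - CW_m_gf (ln 2) / (2 * ln 2) * (1 / ln 2) ^ n)"
      by (simp add: coeff K l_def)
    finally show ?thesis by (simp only: norm_of_real)
  qed
  then show ?thesis by blast
qed

text \<open>Since 2 pi < 6.3, the logarithm has to contribute: 4 * 3.14^2 + 0.6^2 = 39.7984 exceeds
  6.3^2 = 39.69.\<close>

lemma radius_gt_6_3: "6.3 < sqrt (4 * pi\<^sup>2 + (ln 2)\<^sup>2)"
proof (rule real_less_rsqrt)
  have "(3.14 :: real)\<^sup>2 \<le> pi\<^sup>2"
    using pi_approx by (intro power_mono) auto
  moreover have "(0.6 :: real)\<^sup>2 \<le> (ln 2)\<^sup>2"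
    using ln2_ge_two_thirds by (intro power_mono) auto
  ultimately show "(6.3 :: real)\<^sup>2 < 4 * pi\<^sup>2 + (ln 2)\<^sup>2"
    by (simp add: power2_eq_square)
qed

theorem theorem6:
  shows "(\<forall>\<epsilon>::real. 0 < \<epsilon> \<and> \<epsilon> < sqrt (4 * pi\<^sup>2 + (ln 2)\<^sup>2) \<longrightarrow>
            (\<exists>C::real. \<forall>L::nat.
               \<bar>CW_M L - CW_m_gf (ln 2) / (2 * ln 2) * (1 / ln 2) ^ L * fact L\<bar>
                 \<le> C * (sqrt (4 * pi\<^sup>2 + (ln 2)\<^sup>2) - \<epsilon>) powi (- int L) * fact L))
       \<and> (\<exists>(C::real) E::nat \<Rightarrow> real. \<forall>L::nat.
            CW_M L = (CW_m_gf (ln 2) / (2 * ln 2) * (1 / ln 2) ^ L + E L) * fact L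
            \<and> \<bar>E L\<bar> \<le> C * 6.3 powi (- int L))"
proof (intro conjI allI impI)
  fix \<epsilon> :: real
  assume "0 < \<epsilon> \<and> \<epsilon> < sqrt (4 * pi\<^sup>2 + (ln 2)\<^sup>2)"
  then obtain C where C: "\<And>n. \<bar>CW_M n / fact n - CW_m_gf (ln 2) / (2 * ln 2) * (1 / ln 2) ^ n\<bar>
      \<le> C / (sqrt (4 * pi\<^sup>2 + (ln 2)\<^sup>2) - \<epsilon>) ^ n"
    using CW_M_asymptotics[of "sqrt (4 * pi\<^sup>2 + (ln 2)\<^sup>2) - \<epsilon>"] by auto
  have "\<bar>CW_M L - CW_m_gf (ln 2) / (2 * ln 2) * (1 / ln 2) ^ L * fact L\<bar>
          \<le> C * (sqrt (4 * pi\<^sup>2 + (ln 2)\<^sup>2) - \<epsilon>) powi (- int L) * fact L" for L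
  proof -
    have "\<bar>CW_M L - CW_m_gf (ln 2) / (2 * ln 2) * (1 / ln 2) ^ L * fact L\<bar> =
            \<bar>(CW_M L / fact L - CW_m_gf (ln 2) / (2 * ln 2) * (1 / ln 2) ^ L) * fact L\<bar>"
      by (simp only: left_diff_distrib) simp
    also have "\<dots> = \<bar>CW_M L / fact L - CW_m_gf (ln 2) / (2 * ln 2) * (1 / ln 2) ^ L\<bar> * fact L"
      by (simp only: abs_mult) simp
    also have "\<dots> \<le> C / (sqrt (4 * pi\<^sup>2 + (ln 2)\<^sup>2) - \<epsilon>) ^ L * fact L"
      by (intro mult_right_mono C) simp
    finally show ?thesis
      by (simp only: power_int_minus power_int_of_nat divide_inverse)
  qed
  then show "\<exists>C. \<forall>L. \<bar>CW_M L - CW_m_gf (ln 2) / (2 * ln 2) * (1 / ln 2) ^ L * fact L\<bar>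
      \<le> C * (sqrt (4 * pi\<^sup>2 + (ln 2)\<^sup>2) - \<epsilon>) powi (- int L) * fact L"
    by blast
next
  \<comment> \<open>The normalised error itself is the witness, so the required identity is
    immediate and only the bound at radius 6.3 remains.\<close>
  define E where "E = (\<lambda>L. CW_M L / fact L - CW_m_gf (ln 2) / (2 * ln 2) * (1 / ln 2) ^ L)"
  obtain C where C: "\<And>L. \<bar>E L\<bar> \<le> C / 6.3 ^ L"
    using CW_M_asymptotics[OF _ radius_gt_6_3] unfolding E_def by auto
  show "\<exists>C E. \<forall>L. CW_M L = (CW_m_gf (ln 2) / (2 * ln 2) * (1 / ln 2) ^ L + E L) * fact L
            \<and> \<bar>E L\<bar> \<le> C * 6.3 powi (- int L)"
  proof (intro exI allI conjI)
    fix L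
    show "CW_M L = (CW_m_gf (ln 2) / (2 * ln 2) * (1 / ln 2) ^ L + E L) * fact L"
      by (simp add: E_def)
    show "\<bar>E L\<bar> \<le> C * 6.3 powi (- int L)"
      using C[of L] by (simp only: power_int_minus power_int_of_nat divide_inverse)
  qed
qed

end
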